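(* Let $K,N\ge1$ be integers, $\sigma^2>0$, $\rho_k\in\mathbb{R}$ and $h_k,g_{k,n},f_n\in\mathbb{C}$ for $1\le k\le K$, $1\le n\le N$. Given $a_{k,1},a_{k,2}\in\mathbb{C}$ ($1\le k\le K$), $b_n\in\mathbb{C}$ ($1\le n\le N$) and $c_2\in\mathbb{C}$, the optimal $c_1^*\in\mathbb{C}$ that minimizes, over $c_1\in\mathbb{C}$, $$\sum_{k=1}^K\left|c_1h_ka_{k,1}+c_2\left(h_ka_{k,2}+a_{k,1}\sum_{n=1}^Nf_nb_ng_{k,n}\right)-\rho_k\right|^2+|c_1|^2\sigma^2$$ is given by $$c_1^*=\frac{\sum_{k=1}^K\left[\rho_k-c_2\left(h_ka_{k,2}+a_{k,1}\sum_{n=1}^Nf_nb_ng_{k,n}\right)\right]\overline{h_ka_{k,1}}}{\sum_{k=1}^K|h_k|^2|a_{k,1}|^2+\sigma^2}.$$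
   Context: Overline denotes complex conjugation. Interpretation: $c_1$ is the receive scalar of an access point in the first phase of a two-phase relay-assisted aggregation scheme with $K$ devices and $N$ relays; the objective is the part of the mean-square aggregation error depending on $c_1$. *)

theory Defs
  imports Complex_Main
begin

text \<open>
  The part of the mean-square aggregation error that depends on the first-phase receive scalar
  \<open>c1\<close>, with \<open>K\<close> devices and \<open>N\<close> relays. Families are functions on the naturals of which only the
  values at the indices 1 to \<open>K\<close> (devices) and 1 to \<open>N\<close> (relays) matter; \<open>g k n\<close> is the channel
  from device \<open>k\<close> to relay \<open>n\<close>.
\<close>

definition c1_objective ::
  "nat \<Rightarrow> nat \<Rightarrow> real \<Rightarrow> (nat \<Rightarrow> real) \<Rightarrow> (nat \<Rightarrow> complex) \<Rightarrow> (nat \<Rightarrow> nat \<Rightarrow> complex) \<Rightarrow>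
   (nat \<Rightarrow> complex) \<Rightarrow> (nat \<Rightarrow> complex) \<Rightarrow> (nat \<Rightarrow> complex) \<Rightarrow> (nat \<Rightarrow> complex) \<Rightarrow>
   complex \<Rightarrow> complex \<Rightarrow> real"
  where
  "c1_objective K N \<sigma> \<rho> h g f a1 a2 b c2 c1 =
     (\<Sum>k=1..K. (cmod (c1 * h k * a1 k
                        + c2 * (h k * a2 k + a1 k * (\<Sum>n=1..N. f n * b n * g k n))
                        - complex_of_real (\<rho> k)))\<^sup>2)
     + (cmod c1)\<^sup>2 * \<sigma>\<^sup>2"

end

theory Submission
  imports Defs
begin

text \<open>
  Completing the square: with \<open>D = (\<Sum>k. |u k|^2) + s\<close> and \<open>c = (\<Sum>k. v k * cnj (u k)) / D\<close>, the regularized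
  least-squares objective in \<open>x\<close> equals \<open>D * |x - c|^2\<close> plus a constant, so \<open>c\<close> is its only minimizer.
\<close>

lemma cmod_diff_power2:
  "(cmod (z - w))\<^sup>2 = (cmod z)\<^sup>2 - 2 * Re (cnj z * w) + (cmod w)\<^sup>2"
  unfolding cmod_power2 by (simp add: power2_eq_square algebra_simps)

lemma regularized_least_squares_complete_square:
  fixes A :: "'i set" and u v :: "'i \<Rightarrow> complex" and s :: real and x :: complex
  defines "D \<equiv> (\<Sum>k\<in>A. (cmod (u k))\<^sup>2) + s"
  defines "c \<equiv> (\<Sum>k\<in>A. v k * cnj (u k)) / complex_of_real D"
  assumes "D \<noteq> 0"
  shows "(\<Sum>k\<in>A. (cmod (x * u k - v k))\<^sup>2) + (cmod x)\<^sup>2 * s =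
         D * (cmod (x - c))\<^sup>2 + ((\<Sum>k\<in>A. (cmod (v k))\<^sup>2) - D * (cmod c)\<^sup>2)"
proof -
  \<comment> \<open>The normal equation: \<open>c\<close> is chosen so that the linear term in
    \<open>x\<close> agrees with that of \<open>D * (cmod (x - c))\<^sup>2\<close>. As
    \<open>D\<close> is real, it can then be pulled out of \<open>Re\<close>.\<close>
  have "(\<Sum>k\<in>A. v k * cnj (u k)) = of_real D * c"
    using \<open>D \<noteq> 0\<close> by (simp add: c_def)
  moreover have "(\<Sum>k\<in>A. Re (cnj (x * u k) * v k)) = Re (cnj x * (\<Sum>k\<in>A. v k * cnj (u k)))"
    unfolding sum_distrib_left Re_sum by (intro sum.cong) (simp_all add: algebra_simps)
  ultimately have cross: "(\<Sum>k\<in>A. Re (cnj (x * u k) * v k)) = D * Re (cnj x * c)"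
    by (simp add: algebra_simps)
  have "(\<Sum>k\<in>A. (cmod (x * u k - v k))\<^sup>2) =
        (cmod x)\<^sup>2 * (\<Sum>k\<in>A. (cmod (u k))\<^sup>2) - 2 * (D * Re (cnj x * c)) + (\<Sum>k\<in>A. (cmod (v k))\<^sup>2)"
    unfolding cross[symmetric] cmod_diff_power2
    by (simp only: sum.distrib sum_subtractf sum_distrib_left norm_mult power_mult_distrib)
  \<comment> \<open>With \<open>D - s\<close> as coefficient of \<open>(cmod x)\<^sup>2\<close>, the
    regularization term \<open>(cmod x)\<^sup>2 * s\<close> restores exactly
    \<open>D\<close>.\<close>
  also have "(\<Sum>k\<in>A. (cmod (u k))\<^sup>2) = D - s"
    by (simp add: D_def)
  finally show ?thesis
    unfolding cmod_diff_power2[of x c] by (simp add: algebra_simps)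
qed

text \<open>At \<open>c\<close> the value is \<open>C\<close>, and \<open>D > 0\<close> makes every
  other value strictly larger; this gives existence and uniqueness of the minimizer at once.\<close>

lemma is_arg_min_dist_power2_iff:
  fixes c :: "'a :: metric_space"
  assumes "\<And>x. F x = D * (dist x c)\<^sup>2 + C" and "D > (0 :: real)"
  shows "is_arg_min F (\<lambda>_. True) x \<longleftrightarrow> x = c"
proof
  assume "is_arg_min F (\<lambda>_. True) x"
  then have "F x \<le> F c"
    by (auto simp: is_arg_min_def not_less)
  then have "D * (dist x c)\<^sup>2 \<le> 0"
    by (simp add: assms(1))
  with \<open>D > 0\<close> show "x = c"
    by (simp add: mult_le_0_iff)
next
  assume "x = c"
  with \<open>D > 0\<close> show "is_arg_min F (\<lambda>_. True) x"
    by (simp add: is_arg_min_def assms(1) not_less)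
qed

theorem proposition3p2:
  fixes K N :: nat
    and \<sigma> :: real
    and \<rho> :: "nat \<Rightarrow> real"
    and h f a1 a2 b :: "nat \<Rightarrow> complex"
    and g :: "nat \<Rightarrow> nat \<Rightarrow> complex"
    and c2 c1_star :: complex
  assumes "K \<ge> 1" and "N \<ge> 1" and "\<sigma>\<^sup>2 > 0"
  shows "is_arg_min (c1_objective K N \<sigma> \<rho> h g f a1 a2 b c2) (\<lambda>_. True) c1_star \<longleftrightarrow>
         c1_star =
           (\<Sum>k=1..K. (complex_of_real (\<rho> k)
                        - c2 * (h k * a2 k + a1 k * (\<Sum>n=1..N. f n * b n * g k n)))
                      * cnj (h k * a1 k))
           / complex_of_real ((\<Sum>k=1..K. (cmod (h k))\<^sup>2 * (cmod (a1 k))\<^sup>2) + \<sigma>\<^sup>2)"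
proof -
  \<comment> \<open>In the \<open>k\<close>-th residual \<open>u k\<close> is the coefficient of the
    unknown scalar, and \<open>v k\<close> is the target: minus everything free of that
    scalar.\<close>
  define u where "u k = h k * a1 k" for k
  define v where "v k = complex_of_real (\<rho> k)
    - c2 * (h k * a2 k + a1 k * (\<Sum>n=1..N. f n * b n * g k n))" for k
  define D where "D = (\<Sum>k=1..K. (cmod (u k))\<^sup>2) + \<sigma>\<^sup>2"
  define c where "c = (\<Sum>k=1..K. v k * cnj (u k)) / complex_of_real D"
  \<comment> \<open>The noise term keeps \<open>D\<close> positive even if every \<open>u k\<close>
    vanishes.\<close>
  have "D > 0"
    unfolding D_def using assms(3) by (intro add_nonneg_pos sum_nonneg) auto
  have objective: "c1_objective K N \<sigma> \<rho> h g f a1 a2 b c2 x =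
      (\<Sum>k=1..K. (cmod (x * u k - v k))\<^sup>2) + (cmod x)\<^sup>2 * \<sigma>\<^sup>2" for x
    unfolding c1_objective_def u_def v_def by (simp add: algebra_simps)
  have "c1_objective K N \<sigma> \<rho> h g f a1 a2 b c2 x =
      D * (dist x c)\<^sup>2 + ((\<Sum>k=1..K. (cmod (v k))\<^sup>2) - D * (cmod c)\<^sup>2)" for x
    unfolding objective dist_norm c_def D_def
    using \<open>D > 0\<close> by (intro regularized_least_squares_complete_square) (simp add: D_def)
  then have "is_arg_min (c1_objective K N \<sigma> \<rho> h g f a1 a2 b c2) (\<lambda>_. True) c1_star \<longleftrightarrow> c1_star = c"
    using \<open>D > 0\<close> by (rule is_arg_min_dist_power2_iff)
  \<comment> \<open>Multiplicativity of the norm splits \<open>(cmod (u k))\<^sup>2\<close> into the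
    product in the stated denominator.\<close>
  then show ?thesis
    by (simp only: c_def D_def u_def v_def norm_mult power_mult_distrib)
qed

end
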